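(* Let $g\in\mathcal{B}$. Then $e^{\operatorname{Re}(\lambda g)}$ is a $B_2$-weight for all $\lambda\in\mathbb{C}$ if and only if for any $\varepsilon>0$ there exists $C(\varepsilon)>0$ such that $$|g(z)-g(\zeta)|\le C(\varepsilon)+\varepsilon\,\beta(z,\zeta),\qquad z,\zeta\in\mathbb{D}.$$
   Context: $\mathbb{D}$ is the open unit disc, $\partial\mathbb{D}$ the unit circle, $m$ is Lebesgue measure on $\partial\mathbb{D}$, $dA$ is normalized Lebesgue area measure on $\mathbb{D}$. The Bloch space $\mathcal{B}$ is the space of analytic functions $g$ on $\mathbb{D}$ with $\|g\|_{\mathcal{B}}=\sup_{z\in\mathbb{D}}(1-|z|^2)|g'(z)|<\infty$. For an arc $I\subset\partial\mathbb{D}$ the associated Carleson square is $Q_I=\{z\in\mathbb{D}\setminus\{0\}: z/|z|\in I,\ 1-|z|<m(I)\}$. A positive integrable function $w$ on $\mathbb{D}$ is a $B_2$-weight if $$[w]_{B_2}^2=\sup_I\Big(\frac1{A(Q_I)}\int_{Q_I}w\,dA\Big)\Big(\frac1{A(Q_I)}\int_{Q_I}w^{-1}\,dA\Big)<\infty,$$ the supremum being over all arcs $I\subset\partial\mathbb{D}$. The hyperbolic metric is $\beta(z,\zeta)=\frac12\log\frac{1+|\phi_z(\zeta)|}{1-|\phi_z(\zeta)|}$, where $\phi_z(\zeta)=\frac{z-\zeta}{1-\bar z\zeta}$, $z,\zeta\in\mathbb{D}$. *)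

theory Defs
  imports "HOL-Complex_Analysis.Complex_Analysis"
begin

abbreviation unit_disc :: "complex set" where
  "unit_disc \<equiv> ball 0 1"

definition Bloch :: "(complex \<Rightarrow> complex) set" where
  "Bloch = {g. g holomorphic_on unit_disc \<and>
     bdd_above ((\<lambda>z. (1 - (cmod z)\<^sup>2) * cmod (deriv g z)) ` unit_disc)}"

text \<open>Arc length on the unit circle, of total mass \<open>2 * pi\<close>.\<close>

definition circle_measure :: "complex measure" where
  "circle_measure = distr (restrict_space lborel {0..<2 * pi}) borel cis"

definition disc_area :: "complex measure" where
  "disc_area = scale_measure (1 / ennreal pi) (lebesgue_on unit_disc)"

text \<open>Arcs are nondegenerate, may contain any of their endpoints, and may be the full circle.\<close>

definition circle_arcs :: "complex set set" where
  "circle_arcs = {cis ` J |J a b. a < b \<and> b \<le> a + 2 * pi \<and> {a<..<b} \<subseteq> J \<and> J \<subseteq> {a..b}}"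

definition Carleson_square :: "complex set \<Rightarrow> complex set" where
  "Carleson_square I =
     {z \<in> unit_disc - {0}. z / of_real (cmod z) \<in> I \<and> 1 - cmod z < measure circle_measure I}"

text \<open>The averages are taken in \<^typ>\<open>ennreal\<close>, so that a non-integrable \<open>1 / w\<close> gives the
  value \<open>\<infinity>\<close>. The supremum is the square of the constant usually written \<open>[w]\<close>.\<close>

definition disc_average :: "complex set \<Rightarrow> (complex \<Rightarrow> real) \<Rightarrow> ennreal" where
  "disc_average Q w = (\<integral>\<^sup>+z\<in>Q. ennreal (w z) \<partial>disc_area) / emeasure disc_area Q"

definition B2_const_sq :: "(complex \<Rightarrow> real) \<Rightarrow> ennreal" where
  "B2_const_sq w =
     (SUP I\<in>circle_arcs. disc_average (Carleson_square I) w *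
        disc_average (Carleson_square I) (\<lambda>z. inverse (w z)))"

definition B2_weight :: "(complex \<Rightarrow> real) \<Rightarrow> bool" where
  "B2_weight w \<longleftrightarrow>
     (\<forall>z\<in>unit_disc. 0 < w z) \<and> integrable disc_area w \<and> B2_const_sq w < \<infinity>"

definition disc_involution :: "complex \<Rightarrow> complex \<Rightarrow> complex" where
  "disc_involution z \<zeta> = (z - \<zeta>) / (1 - cnj z * \<zeta>)"

definition hyperbolic_dist :: "complex \<Rightarrow> complex \<Rightarrow> real" where
  "hyperbolic_dist z \<zeta> =
     1 / 2 * ln ((1 + cmod (disc_involution z \<zeta>)) / (1 - cmod (disc_involution z \<zeta>)))"

end

theory Submission
  imports Defs
begin

text \<open>
  Suppose every weight \<open>exp (Re (c * g))\<close> satisfies the \<open>B\<^sub>2\<close> condition. Two points \<open>z\<close>, \<open>\<zeta>\<close> lie in a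
  common Carleson square of side comparable to \<open>\<bar>1 - cnj z * \<zeta>\<bar>\<close>, together with the discs of radius
  \<open>(1 - \<bar>z\<bar>) / 2\<close> and \<open>(1 - \<bar>\<zeta>\<bar>) / 2\<close> around them. As \<open>g\<close> is a Bloch function, it varies by a
  bounded amount on these discs; keeping only the first disc in the average of the weight and only the
  second one in the average of its inverse bounds \<open>Re (c * (g z - g \<zeta>))\<close> by \<open>K c + 4 * \<beta> z \<zeta>\<close>.
  The factor \<open>4\<close> does not depend on \<open>c\<close>, so the four choices \<open>c = R, -R, \<i> * R, -\<i> * R\<close> with
  \<open>R = 8 / \<epsilon>\<close> give the growth estimate.

  Conversely, take \<open>\<epsilon> < 1 / \<bar>c\<bar>\<close> and compare \<open>g\<close> on a Carleson square of side \<open>h\<close> with its value at the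
  centre \<open>z\<close> of the square. The weight is then at most \<open>exp (Re (c * g z))\<close> times a constant
  multiple of \<open>sqrt (h / (1 - \<bar>u\<bar>))\<close>, whose average over the square is bounded; the same holds with
  \<open>-c\<close> in place of \<open>c\<close>, and the values at \<open>z\<close> cancel in the product.
\<close>

section \<open>Points near the unit circle\<close>

lemma norm_cis_diff_one: "cmod (cis x - 1) = 2 * \<bar>sin (x / 2)\<bar>"
proof (rule power2_eq_imp_eq)
  have "(cmod (cis x - 1))\<^sup>2 = 2 - 2 * cos (2 * (x / 2))"
    unfolding cmod_power2 using sin_cos_squared_add[of x]
    by (simp add: power2_eq_square algebra_simps)
  also have "\<dots> = (2 * \<bar>sin (x / 2)\<bar>)\<^sup>2"
    by (simp only: cos_double_sin) (simp add: power_mult_distrib)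
  finally show "(cmod (cis x - 1))\<^sup>2 = (2 * \<bar>sin (x / 2)\<bar>)\<^sup>2" .
qed simp_all

text \<open>With \<open>y = \<bar>x\<bar> / 2\<close> in \<open>[0, pi / 2]\<close> the chord has
  length \<open>2 * sin y\<close>. The Taylor bound gives \<open>sin y \<ge> y - y ^ 3 / 6\<close>,
  and \<open>y\<^sup>2 \<le> 3\<close> makes this at least \<open>y / 2\<close>.\<close>

lemma abs_le_chord:
  assumes "\<bar>x\<bar> \<le> pi"
  shows "\<bar>x\<bar> \<le> 2 * cmod (cis x - 1)"
proof -
  define y where "y = \<bar>x\<bar> / 2"
  have y: "0 \<le> y" "y \<le> pi / 2" using assms by (auto simp: y_def)
  have "\<bar>sin y - (\<Sum>m<3. sin_coeff m * y ^ m)\<bar> \<le> inverse (fact 3) * \<bar>y\<bar> ^ 3"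
    by (rule Maclaurin_sin_bound)
  moreover have "(\<Sum>m<3. sin_coeff m * y ^ m) = y"
    by (simp add: sin_coeff_def numeral_3_eq_3)
  ultimately have "sin y \<ge> y - y ^ 3 / 6"
    using y by (simp add: fact_numeral abs_le_iff abs_if field_simps split: if_splits)
  moreover have "y ^ 3 / 6 \<le> y / 2"
  proof -
    have "y \<le> 1.6" using y pi_less_4 pi_approx by simp
    then have "y\<^sup>2 \<le> 1.6\<^sup>2" using y by (intro power_mono) auto
    then have "y * y\<^sup>2 \<le> y * 3" using y by (intro mult_left_mono) (auto simp: power2_eq_square)
    then show ?thesis by (simp add: power3_eq_cube power2_eq_square)
  qed
  ultimately have s: "sin y \<ge> y / 2" by simp
  have "\<bar>sin (x / 2)\<bar> = sin y"
    using s y by (cases "0 \<le> x") (auto simp: y_def abs_if)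
  then show ?thesis using s unfolding norm_cis_diff_one by (simp add: y_def)
qed

lemma chord_le_abs: "cmod (cis x - 1) \<le> \<bar>x\<bar>"
  using abs_sin_x_le_abs_x[of "x / 2"] by (simp add: norm_cis_diff_one)

lemma cis_diff_le: "cmod (cis x - cis y) \<le> \<bar>x - y\<bar>"
proof -
  have "cis x - cis y = cis y * (cis (x - y) - 1)"
    by (simp add: cis_mult algebra_simps)
  then have "cmod (cis x - cis y) = cmod (cis (x - y) - 1)"
    by (simp add: norm_mult)
  then show ?thesis using chord_le_abs[of "x - y"] by simp
qed

text \<open>The angle is \<open>s\<close> plus the argument of \<open>v / cis s\<close>, so the
  branch is chosen near \<open>s\<close> and the jump of \<open>Arg\<close> does no harm. This makes
  intervals of angles around \<open>s\<close> usable for points near \<open>cis s\<close>.\<close>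

lemma unit_near_cis:
  assumes "cmod v = 1"
  obtains t where "v = cis t" "\<bar>t - s\<bar> \<le> 2 * cmod (v - cis s)"
proof -
  define x where "x = Arg (v / cis s)"
  have "v / cis s \<noteq> 0" using assms by auto
  then have "cis x = v / cis s"
    using assms by (simp add: x_def cis_Arg sgn_div_norm norm_divide)
  then have v: "v = cis (s + x)" by (simp add: cis_mult[symmetric])
  have "cmod (v - cis s) = cmod (cis s * (cis x - 1))"
    using v by (simp add: cis_mult algebra_simps)
  then have "cmod (v - cis s) = cmod (cis x - 1)" by (simp add: norm_mult)
  moreover have "\<bar>x\<bar> \<le> pi" using Arg_bounded[of "v / cis s"] by (simp add: x_def abs_le_iff)
  ultimately show ?thesis using abs_le_chord[of x] that[OF v] by simp
qed

text \<open>Radial projection is Lipschitz away from the origin. Multiplied by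
  \<open>norm z\<close>, the difference splits into a radial correction and \<open>u - z\<close>,
  each of norm at most \<open>norm (u - z)\<close>.\<close>

lemma norm_sgn_diff_le:
  fixes u z :: "'a::real_normed_vector"
  assumes "u \<noteq> 0" "z \<noteq> 0"
  shows "norm (sgn u - sgn z) \<le> 2 * norm (u - z) / norm z"
proof -
  have "norm z *\<^sub>R (sgn u - sgn z) = (norm z - norm u) *\<^sub>R sgn u + (u - z)"
    using assms by (simp add: sgn_div_norm algebra_simps)
  then have "norm z * norm (sgn u - sgn z) \<le> norm ((norm z - norm u) *\<^sub>R sgn u) + norm (u - z)"
    by (metis abs_norm_cancel norm_scaleR norm_triangle_ineq)
  also have "norm ((norm z - norm u) *\<^sub>R sgn u) \<le> norm (u - z)"
    using assms norm_triangle_ineq3[of z u] by (simp add: norm_sgn norm_minus_commute)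
  finally show ?thesis using assms by (simp add: field_simps)
qed

section \<open>Area and arc length\<close>

lemma space_disc_area [simp]: "space disc_area = unit_disc"
  by (simp add: disc_area_def space_scale_measure)

lemma sets_disc_area: "A \<in> sets disc_area \<longleftrightarrow> A \<in> sets lebesgue \<and> A \<subseteq> unit_disc"
  by (auto simp: disc_area_def sets_restrict_space_iff)

lemma emeasure_disc_area:
  assumes "A \<subseteq> unit_disc"
  shows "emeasure disc_area A = ennreal (1 / pi) * emeasure lebesgue A"
proof -
  have "1 / ennreal pi = ennreal (1 / pi)"
    using divide_ennreal[of 1 pi] by simp
  then show ?thesis using assms by (simp add: disc_area_def emeasure_restrict_space)
qed

lemma emeasure_lebesgue_disc:
  assumes "r \<ge> 0"
  shows "ennreal (1 / pi) * emeasure lebesgue (ball (z::complex) r) = ennreal (r\<^sup>2)"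
  using assms by (simp add: emeasure_ball unit_ball_vol_2 flip: ennreal_mult)

lemma emeasure_disc_area_ball:
  assumes "ball z r \<subseteq> unit_disc" "r \<ge> 0"
  shows "emeasure disc_area (ball z r) = ennreal (r\<^sup>2)"
  using assms by (simp only: emeasure_disc_area emeasure_lebesgue_disc)

lemma emeasure_disc_area_ball_le:
  assumes "r \<ge> 0"
  shows "emeasure disc_area (ball z r \<inter> unit_disc) \<le> ennreal (r\<^sup>2)"
proof -
  have "emeasure disc_area (ball z r \<inter> unit_disc) = ennreal (1 / pi) * emeasure lebesgue (ball z r \<inter> unit_disc)"
    by (rule emeasure_disc_area) auto
  also have "\<dots> \<le> ennreal (1 / pi) * emeasure lebesgue (ball z r)"
    by (intro mult_left_mono emeasure_mono) auto
  also have "\<dots> = ennreal (r\<^sup>2)" by (rule emeasure_lebesgue_disc[OF assms])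
  finally show ?thesis .
qed

lemma emeasure_disc_area_space: "emeasure disc_area unit_disc = 1"
  using emeasure_disc_area_ball[of 0 1] by simp

lemma emeasure_disc_area_singleton: "emeasure disc_area {z} = 0"
proof (cases "z \<in> unit_disc")
  case True
  then show ?thesis by (simp add: emeasure_disc_area)
next
  case False
  then show ?thesis by (simp add: emeasure_notin_sets sets_disc_area)
qed

lemma borel_measurable_disc_area:
  fixes f :: "complex \<Rightarrow> 'a::euclidean_space"
  assumes "continuous_on unit_disc f"
  shows "f \<in> borel_measurable disc_area"
proof -
  have "f \<in> borel_measurable (lebesgue_on unit_disc)"
    by (rule continuous_imp_measurable_on_sets_lebesgue[OF assms]) auto
  then show ?thesis by (simp add: disc_area_def measurable_def space_scale_measure)
qed

section \<open>Measurability and length of arcs\<close>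

lemma circle_arcsI:
  assumes "a < b" "b \<le> a + 2 * pi" "{a<..<b} \<subseteq> J" "J \<subseteq> {a..b}"
  shows "cis ` J \<in> circle_arcs"
  using assms unfolding circle_arcs_def by blast

text \<open>The open interval is a countable union of compact intervals, whose images under
  \<open>cis\<close> are compact. The endpoints that belong to \<open>J\<close> add a finite
  set.\<close>

lemma cis_image_borel:
  assumes J: "{a<..<b} \<subseteq> J" "J \<subseteq> {a..b::real}"
  shows "cis ` J \<in> sets borel"
proof -
  have "cis ` {a<..<b} = (\<Union>n. cis ` {a + 1 / Suc n..b - 1 / Suc n})"
  proof -
    have "{a<..<b} = (\<Union>n. {a + 1 / Suc n..b - 1 / Suc n})"
    proof (intro equalityI subsetI)
      fix x assume "x \<in> {a<..<b}"
      then have "0 < min (x - a) (b - x)" by auto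
      then obtain n where "inverse (real (Suc n)) < min (x - a) (b - x)"
        using reals_Archimedean by blast
      then show "x \<in> (\<Union>n. {a + 1 / Suc n..b - 1 / Suc n})"
        by (auto simp: field_simps intro!: exI[of _ n])
    next
      fix x assume "x \<in> (\<Union>n. {a + 1 / Suc n..b - 1 / Suc n})"
      then obtain n where "a + 1 / Suc n \<le> x" "x \<le> b - 1 / Suc n" by auto
      moreover have "1 / real (Suc n) > 0" by simp
      ultimately show "x \<in> {a<..<b}" unfolding greaterThanLessThan_iff by linarith
    qed
    then show ?thesis by auto
  qed
  moreover have "cis ` {c..d} \<in> sets borel" for c d
    by (intro borel_compact compact_continuous_image continuous_intros) auto
  ultimately have "cis ` {a<..<b} \<in> sets borel"
    by (metis (no_types, lifting) sets.countable_UN image_subset_iff)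
  moreover have "cis ` (J \<inter> {a, b}) \<in> sets borel"
    by (intro borel_closed finite_imp_closed) auto
  ultimately have "cis ` {a<..<b} \<union> cis ` (J \<inter> {a, b}) \<in> sets borel"
    by (rule sets.Un)
  also have "cis ` {a<..<b} \<union> cis ` (J \<inter> {a, b}) = cis ` J"
  proof -
    have "{a<..<b} \<union> (J \<inter> {a, b}) = J"
    proof (intro equalityI subsetI)
      fix x assume "x \<in> J"
      then have "a \<le> x" "x \<le> b" using J by auto
      then show "x \<in> {a<..<b} \<union> (J \<inter> {a, b})"
        using \<open>x \<in> J\<close> by (cases "x = a"; cases "x = b") auto
    qed (use J in auto)
    then show ?thesis by (simp flip: image_Un)
  qed
  finally show ?thesis .
qed

lemma cis_eq_cis_iff: "cis x = cis y \<longleftrightarrow> (\<exists>k::int. x = y + 2 * pi * of_int k)"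
  using sin_cos_eq_iff[of x y] by (auto simp: complex_eq_iff mult_ac)

text \<open>With the starting angle in \<open>[0, 2 * pi)\<close>, the arc passes the angle
  \<open>2 * pi\<close> at most once, and what lies beyond reappears at the start of
  \<open>[0, 2 * pi)\<close>.\<close>

lemma measure_circle_arc_aux:
  assumes ab: "0 \<le> a" "a < 2 * pi" "a < b" "b \<le> a + 2 * pi"
    and J: "{a<..<b} \<subseteq> J" "J \<subseteq> {a..b::real}"
  shows "measure circle_measure (cis ` J) = b - a"
proof -
  define P where "P = {t \<in> {0..<2 * pi}. cis t \<in> cis ` J}"
  have meas: "cis ` J \<in> sets borel" by (rule cis_image_borel[OF J])
  have cis: "cis \<in> borel_measurable borel"
    by (intro borel_measurable_continuous_onI continuous_intros)
  have P: "P \<in> sets borel"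
  proof -
    have "P = (cis -` (cis ` J)) \<inter> {0..<2 * pi}" by (auto simp: P_def)
    then show ?thesis using measurable_sets[OF cis meas] by auto
  qed
  have "emeasure circle_measure (cis ` J) = emeasure lborel P"
    unfolding circle_measure_def
    using meas cis
    by (subst emeasure_distr)
      (auto simp: measurable_restrict_space1 emeasure_restrict_space space_restrict_space P_def
        intro!: arg_cong2[where f=emeasure])
  then have eq: "measure circle_measure (cis ` J) = measure lborel P" by (simp add: measure_def)
  \<comment> \<open>\<open>P\<close> is squeezed between \<open>L\<close> and \<open>U\<close>,
    which differ by finitely many points. Both have measure \<open>b - a\<close>, so it does not
    matter which endpoints \<open>J\<close> contains.\<close>
  define L where "L = {a<..<min b (2 * pi)} \<union> {0..<b - 2 * pi}"
  define U where "U = {0} \<union> {a..min b (2 * pi)} \<union> {0..b - 2 * pi}"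
  have "L \<subseteq> P"
  proof
    fix t assume "t \<in> L"
    then consider "t \<in> {a<..<min b (2 * pi)}" | "t \<in> {0..<b - 2 * pi}" by (auto simp: L_def)
    then show "t \<in> P"
    proof cases
      case 1
      then show ?thesis using ab J by (auto simp: P_def)
    next
      case 2
      then have "t + 2 * pi \<in> J" using ab J by auto
      moreover have "cis (t + 2 * pi) = cis t" by (simp add: cis_mult[symmetric])
      ultimately show ?thesis using 2 ab by (auto simp: P_def intro!: rev_image_eqI)
    qed
  qed
  moreover have "P \<subseteq> U"
  proof
    fix t assume "t \<in> P"
    then obtain j where j: "j \<in> J" "cis t = cis j" "0 \<le> t" "t < 2 * pi" by (auto simp: P_def)
    then obtain k :: int where k: "j = t + 2 * pi * of_int k" using cis_eq_cis_iff by metis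
    have "a \<le> j" "j \<le> b" using j J by auto
    \<comment> \<open>From \<open>0 \<le> a \<le> j \<le> b < 4 * pi\<close> and
      \<open>0 \<le> t < 2 * pi\<close>, the difference \<open>j - t\<close> lies strictly between
      \<open>-2 * pi\<close> and \<open>4 * pi\<close>. This leaves only \<open>k = 0\<close> and
      \<open>k = 1\<close>.\<close>
    have "2 * pi * of_int k > 2 * pi * (-1)" "2 * pi * of_int k < 2 * pi * 2"
      using k \<open>a \<le> j\<close> \<open>j \<le> b\<close> j ab by linarith+
    then have "(-1::real) < of_int k" "of_int k < (2::real)"
      by (simp_all only: mult_less_cancel_left_pos zero_less_mult_iff pi_gt_zero zero_less_numeral simp_thms)
    then have "k > -1" "k < 2" by linarith+
    then have "k = 0 \<or> k = 1" by auto
    then show "t \<in> U" using k j \<open>a \<le> j\<close> \<open>j \<le> b\<close> by (auto simp: U_def)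
  qed
  moreover have "measure lborel L = b - a"
  proof (cases "b \<le> 2 * pi")
    case True
    then show ?thesis using ab by (simp add: L_def min_def)
  next
    case False
    then show ?thesis using ab unfolding L_def
      by (subst measure_Union) (auto simp: min_def)
  qed
  moreover have "measure lborel U \<le> b - a"
  proof -
    have "measure lborel U \<le> measure lborel ({0} \<union> {a..min b (2 * pi)}) + measure lborel {0..b - 2 * pi}"
      unfolding U_def by (rule measure_Un_le) auto
    moreover have "measure lborel ({0} \<union> {a..min b (2 * pi)}) \<le> measure lborel {0::real} + measure lborel {a..min b (2 * pi)}"
      by (rule measure_Un_le) auto
    ultimately show ?thesis using ab
      by (cases "b = 2 * pi"; cases "b \<le> 2 * pi") (auto simp: min_def)
  qed
  moreover have U: "U \<in> fmeasurable lborel"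
    unfolding U_def by (intro fmeasurable_compact compact_Un) auto
  moreover have "P \<in> fmeasurable lborel"
    by (rule fmeasurableI2[OF U \<open>P \<subseteq> U\<close>]) (use P in simp)
  moreover have "L \<in> sets lborel" by (simp add: L_def)
  ultimately show ?thesis
    using eq measure_mono_fmeasurable[of P U lborel] measure_mono_fmeasurable[of L P lborel] P
    by simp
qed

lemma measure_circle_arc:
  assumes ab: "a < b" "b \<le> a + 2 * pi" and J: "{a<..<b} \<subseteq> J" "J \<subseteq> {a..b::real}"
  shows "measure circle_measure (cis ` J) = b - a"
proof -
  define k where "k = \<lfloor>a / (2 * pi)\<rfloor>"
  define s where "s = 2 * pi * of_int k"
  have k: "of_int k \<le> a / (2 * pi)" "a / (2 * pi) < of_int k + 1" by (auto simp: k_def)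
  have "cis (x - s) = cis x" for x
    by (simp add: s_def cis_divide[symmetric])
  then have "cis ` J = cis ` ((\<lambda>x. x - s) ` J)" by (simp add: image_image)
  also have "measure circle_measure \<dots> = (b - s) - (a - s)"
  proof (rule measure_circle_arc_aux)
    show "0 \<le> a - s" "a - s < 2 * pi" using k by (auto simp: s_def field_simps)
    show "{a - s<..<b - s} \<subseteq> (\<lambda>x. x - s) ` J"
    proof
      fix x assume "x \<in> {a - s<..<b - s}"
      then have "x + s \<in> J" using J by auto
      then show "x \<in> (\<lambda>x. x - s) ` J" by (auto intro!: image_eqI[of _ _ "x + s"])
    qed
  qed (use assms in auto)
  finally show ?thesis by simp
qed

section \<open>Carleson squares in terms of angles, and their measurability\<close>

lemma Carleson_square_arc:
  assumes "a < b" "b \<le> a + 2 * pi" "{a<..<b} \<subseteq> J" "J \<subseteq> {a..b}"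
  shows "Carleson_square (cis ` J) = {z \<in> unit_disc. z \<noteq> 0 \<and> sgn z \<in> cis ` J \<and> 1 - cmod z < b - a}"
  using measure_circle_arc[OF assms]
  by (auto simp: Carleson_square_def sgn_div_norm scaleR_conv_of_real divide_inverse mult.commute)

lemma Carleson_square_sets:
  assumes "I \<in> circle_arcs"
  shows "Carleson_square I \<in> sets disc_area"
proof -
  have I: "I \<in> sets borel" using assms by (auto simp: circle_arcs_def intro: cis_image_borel)
  have "Carleson_square I = sgn -` I \<inter> (unit_disc - {0}) \<inter> {z. 1 - cmod z < measure circle_measure I}"
    by (auto simp: Carleson_square_def sgn_div_norm scaleR_conv_of_real divide_inverse mult.commute)
  moreover have "(sgn :: complex \<Rightarrow> complex) \<in> borel_measurable borel"
    unfolding sgn_div_norm by (intro borel_measurable_scaleR borel_measurable_inverse) auto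
  then have "sgn -` I \<in> sets (borel :: complex measure)"
    using measurable_sets[of sgn borel borel I] I by (simp add: space_borel)
  ultimately have "Carleson_square I \<in> sets borel" by simp
  then show ?thesis by (auto simp: sets_disc_area Carleson_square_def)
qed

section \<open>The hyperbolic metric\<close>

text \<open>The classical identity for the disc automorphism: divided by
  \<open>(cmod (1 - cnj z * \<zeta>))\<^sup>2\<close>, it computes
  \<open>1 - (cmod (disc_involution z \<zeta>))\<^sup>2\<close>.\<close>

lemma one_minus_cnj_mult:
  "(cmod (1 - cnj z * \<zeta>))\<^sup>2 - (cmod (z - \<zeta>))\<^sup>2 = (1 - (cmod z)\<^sup>2) * (1 - (cmod \<zeta>)\<^sup>2)"
  unfolding cmod_power2 by (simp add: power2_eq_square algebra_simps)

lemma
  assumes "z \<in> unit_disc" "\<zeta> \<in> unit_disc"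
  shows norm_one_minus_cnj_mult_pos: "0 < cmod (1 - cnj z * \<zeta>)"
    and norm_diff_less_one_minus_cnj_mult: "cmod (z - \<zeta>) < cmod (1 - cnj z * \<zeta>)"
    and one_minus_norm_le_one_minus_cnj_mult: "1 - cmod z \<le> cmod (1 - cnj z * \<zeta>)"
      "1 - cmod \<zeta> \<le> cmod (1 - cnj z * \<zeta>)"
proof -
  have z: "cmod z < 1" "cmod \<zeta> < 1" using assms by auto
  have *: "1 - cmod z * cmod \<zeta> \<le> cmod (1 - cnj z * \<zeta>)"
    using norm_triangle_ineq2[of 1 "cnj z * \<zeta>"] by (simp add: norm_mult)
  have "cmod z * cmod \<zeta> \<le> cmod z" "cmod z * cmod \<zeta> \<le> cmod \<zeta>"
    using z by (auto intro: mult_left_le mult_left_le_one_le)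
  then show "0 < cmod (1 - cnj z * \<zeta>)" "1 - cmod z \<le> cmod (1 - cnj z * \<zeta>)"
      "1 - cmod \<zeta> \<le> cmod (1 - cnj z * \<zeta>)" using * z by linarith+
  have "0 < (1 - (cmod z)\<^sup>2) * (1 - (cmod \<zeta>)\<^sup>2)"
    using z by (intro mult_pos_pos) (auto simp: power_less_one_iff abs_square_less_1)
  then have "(cmod (z - \<zeta>))\<^sup>2 < (cmod (1 - cnj z * \<zeta>))\<^sup>2"
    using one_minus_cnj_mult[of z \<zeta>] by linarith
  then show "cmod (z - \<zeta>) < cmod (1 - cnj z * \<zeta>)" by (rule power2_less_imp_less) simp
qed

text \<open>With \<open>p = cmod (disc_involution z \<zeta>)\<close>, the quotient \<open>q\<close>
  equals \<open>1 / (1 - p\<^sup>2)\<close>, while the exponential is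
  \<open>(1 + p) / (1 - p) = (1 + p)\<^sup>2 * q\<close>. The factor \<open>(1 + p)\<^sup>2\<close>
  lies between 1 and 4.\<close>

lemma
  assumes "z \<in> unit_disc" "\<zeta> \<in> unit_disc"
  defines "q \<equiv> (cmod (1 - cnj z * \<zeta>))\<^sup>2 / ((1 - (cmod z)\<^sup>2) * (1 - (cmod \<zeta>)\<^sup>2))"
  shows exp_hyperbolic_dist_lower: "q \<le> exp (2 * hyperbolic_dist z \<zeta>)"
    and exp_hyperbolic_dist_upper: "exp (2 * hyperbolic_dist z \<zeta>) \<le> 4 * q"
    and hyperbolic_dist_nonneg: "0 \<le> hyperbolic_dist z \<zeta>"
proof -
  define p where "p = cmod (disc_involution z \<zeta>)"
  define d where "d = cmod (1 - cnj z * \<zeta>)"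
  have d: "0 < d" using norm_one_minus_cnj_mult_pos[OF assms(1,2)] by (simp add: d_def)
  have pd: "p = cmod (z - \<zeta>) / d" by (simp add: p_def d_def disc_involution_def norm_divide)
  then have p: "0 \<le> p" "p < 1"
    using norm_diff_less_one_minus_cnj_mult[OF assms(1,2)] d by (auto simp: d_def)
  have *: "(1 - p\<^sup>2) * d\<^sup>2 = (1 - (cmod z)\<^sup>2) * (1 - (cmod \<zeta>)\<^sup>2)"
    using d one_minus_cnj_mult[of z \<zeta>, folded d_def] by (simp add: pd power_divide algebra_simps)
  have "q = d\<^sup>2 / ((1 - p\<^sup>2) * d\<^sup>2)" unfolding * unfolding q_def d_def ..
  then have q: "q = 1 / (1 - p\<^sup>2)" using d by simp
  have e: "exp (2 * hyperbolic_dist z \<zeta>) = (1 + p) / (1 - p)"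
    using p by (simp add: hyperbolic_dist_def exp_ln flip: p_def)
  have f: "1 - p\<^sup>2 = (1 - p) * (1 + p)" by (simp add: power2_eq_square algebra_simps)
  have "(1 + p) / (1 - p) = (1 + p)\<^sup>2 * q"
    using p unfolding q f by (simp add: power2_eq_square)
  moreover have "q \<ge> 0" using p unfolding q f by simp
  moreover have "1 \<le> (1 + p)\<^sup>2" "(1 + p)\<^sup>2 \<le> 2\<^sup>2"
    using p power_mono[of "1 + p" 2 2] by simp_all
  ultimately show "q \<le> exp (2 * hyperbolic_dist z \<zeta>)" "exp (2 * hyperbolic_dist z \<zeta>) \<le> 4 * q"
    unfolding e using mult_right_mono[of 1 "(1 + p)\<^sup>2" q] mult_right_mono[of "(1 + p)\<^sup>2" 4 q] by auto
  show "0 \<le> hyperbolic_dist z \<zeta>"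
    using p by (simp add: hyperbolic_dist_def flip: p_def)
qed

text \<open>The factor 4 is the product of the constants 2 in \<open>norm_sgn_diff_le\<close> and
  \<open>unit_near_cis\<close>.\<close>

lemma sgn_near_cis:
  assumes "u \<noteq> 0" "z \<noteq> 0" "sgn z = cis s" "4 * cmod (u - z) < r * cmod z"
  obtains t where "sgn u = cis t" "\<bar>t - s\<bar> < r"
proof -
  have "cmod (sgn u) = 1" using assms by (simp add: norm_sgn)
  then obtain t where t: "sgn u = cis t" "\<bar>t - s\<bar> \<le> 2 * cmod (sgn u - cis s)"
    by (rule unit_near_cis)
  have "2 * cmod (sgn u - cis s) \<le> 2 * (2 * cmod (u - z) / cmod z)"
    using norm_sgn_diff_le[OF assms(1,2)] assms(3) by simp
  also have "2 * (2 * cmod (u - z) / cmod z) < r" using assms by (simp add: field_simps)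
  finally show ?thesis using that t by simp
qed

text \<open>Go from \<open>u\<close> radially to the circle and then along the circle to
  \<open>cis s\<close>.\<close>

lemma norm_diff_cis_le:
  assumes "u \<in> unit_disc" "u \<noteq> 0" "sgn u = cis t"
  shows "cmod (u - cis s) \<le> (1 - cmod u) + \<bar>t - s\<bar>"
proof -
  have "u - cis t = of_real (cmod u - 1) * cis t"
    using assms by (simp add: sgn_div_norm scaleR_conv_of_real field_simps flip: assms(3))
  then have "cmod (u - cis t) = 1 - cmod u"
    using assms by (simp add: norm_mult del: of_real_diff)
  moreover have "cmod (u - cis s) \<le> cmod (u - cis t) + cmod (cis t - cis s)"
    using norm_triangle_ineq[of "u - cis t" "cis t - cis s"] by simp
  ultimately show ?thesis using cis_diff_le[of t s] by simp
qed

section \<open>Carleson squares\<close>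

lemma Carleson_square_subset: "Carleson_square I \<subseteq> unit_disc - {0}"
  by (auto simp: Carleson_square_def)

lemma full_circle_interval:
  "0 < 2 * pi" "2 * pi \<le> 0 + 2 * pi" "{0<..<2 * pi} \<subseteq> {0..2 * pi}" "{0..2 * pi} \<subseteq> {0..2 * pi}"
  by auto

text \<open>The full circle has length \<open>2 * pi > 1\<close>, so the height condition holds
  throughout the disc.\<close>

lemma Carleson_square_circle: "Carleson_square (cis ` {0..2 * pi}) = unit_disc - {0}"
proof -
  have "sgn u \<in> cis ` {0..2 * pi}" if "u \<noteq> 0" for u
  proof -
    have "sgn u = cis (Arg2pi u)"
      using that Arg2pi_eq[of u] by (simp add: sgn_div_norm scaleR_conv_of_real cis_conv_exp field_simps)
    moreover have "Arg2pi u \<in> {0..2 * pi}" using Arg2pi[of u] by auto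
    ultimately show ?thesis by blast
  qed
  then show ?thesis
    using pi_gt3 unfolding Carleson_square_arc[OF full_circle_interval] by (auto intro: le_less_trans[of _ 1])
qed

lemma exists_Carleson_square:
  assumes z: "z \<in> unit_disc" and \<zeta>: "\<zeta> \<in> unit_disc"
  obtains I where "I \<in> circle_arcs"
    "ball z ((1 - cmod z) / 2) - {0} \<subseteq> Carleson_square I"
    "ball \<zeta> ((1 - cmod \<zeta>) / 2) - {0} \<subseteq> Carleson_square I"
    "emeasure disc_area (Carleson_square I) \<le> ennreal (1296 * (cmod (1 - cnj z * \<zeta>))\<^sup>2)"
proof -
  define d where "d = cmod (1 - cnj z * \<zeta>)"
  note d = norm_one_minus_cnj_mult_pos[OF assms, folded d_def]
    norm_diff_less_one_minus_cnj_mult[OF assms, folded d_def]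
    one_minus_norm_le_one_minus_cnj_mult[OF assms, folded d_def]
  have ball: "u \<in> unit_disc" if "u \<in> ball v ((1 - cmod v) / 2)" "v \<in> unit_disc" for u v
  proof -
    have "cmod u \<le> cmod v + cmod (v - u)" using norm_triangle_ineq2[of u v] by (simp add: norm_minus_commute)
    also have "\<dots> < cmod v + (1 - cmod v) / 2" using that by (simp add: dist_norm)
    also have "\<dots> \<le> 1" using that(2) by (simp add: field_simps)
    finally show ?thesis by simp
  qed
  show ?thesis
  \<comment> \<open>For \<open>d \<ge> 1 / 4\<close> the whole punctured disc serves, since its area
    is at most \<open>1 \<le> 1296 * d\<^sup>2\<close>. For \<open>d < 1 / 4\<close> the point
    \<open>z\<close> is far from the origin and has a usable argument.\<close>
  proof (cases "d \<ge> 1 / 4")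
    case True
    note J = full_circle_interval and Q = Carleson_square_circle
    have "emeasure disc_area (unit_disc - {0}) \<le> emeasure disc_area unit_disc"
      by (rule emeasure_mono) (auto simp: sets_disc_area)
    also have "\<dots> \<le> ennreal (1296 * d\<^sup>2)"
    proof -
      have "(1 / 4)\<^sup>2 \<le> d\<^sup>2" using True by (intro power_mono) auto
      then have "1 \<le> 1296 * d\<^sup>2" by (simp add: power2_eq_square)
      then show ?thesis using ennreal_leI[of 1] by (simp add: emeasure_disc_area_space)
    qed
    finally have "emeasure disc_area (Carleson_square (cis ` {0..2 * pi})) \<le> ennreal (1296 * d\<^sup>2)"
      unfolding Q .
    moreover have "ball z ((1 - cmod z) / 2) - {0} \<subseteq> Carleson_square (cis ` {0..2 * pi})"
      "ball \<zeta> ((1 - cmod \<zeta>) / 2) - {0} \<subseteq> Carleson_square (cis ` {0..2 * pi})"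
      using ball z \<zeta> unfolding Q by blast+
    ultimately show ?thesis
      by (intro that[OF circle_arcsI[OF J]]) (simp_all only: d_def)
  next
    case False
    define s where "s = Arg z"
    \<comment> \<open>Points \<open>u\<close> of both discs satisfy
      \<open>cmod (u - z) < 3 / 2 * d\<close>. As \<open>cmod z \<ge> 1 / 2\<close>,
      \<open>sgn_near_cis\<close> places their angles within \<open>12 * d\<close> of
      \<open>s\<close>. The total length \<open>24 * d\<close> stays below
      \<open>6 < 2 * pi\<close>.\<close>
    define J where "J = {s - 12 * d..s + 12 * d}"
    have z0: "z \<noteq> 0" using d False by auto
    then have sz: "sgn z = cis s" by (simp add: s_def cis_Arg)
    have J: "s - 12 * d < s + 12 * d" "s + 12 * d \<le> s - 12 * d + 2 * pi"
      "{s - 12 * d<..<s + 12 * d} \<subseteq> J" "J \<subseteq> {s - 12 * d..s + 12 * d}"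
      using d False pi_gt3 by (auto simp: J_def)
    note Q = Carleson_square_arc[OF J]
    have sub: "u \<in> Carleson_square (cis ` J)"
      if u: "u \<noteq> 0" "u \<in> ball v ((1 - cmod v) / 2)" and v: "v \<in> unit_disc" "cmod (z - v) < d" "1 - cmod v \<le> d"
      for u v
    proof -
      have "cmod (u - v) < d / 2" using u v by (simp add: dist_norm norm_minus_commute)
      then have "cmod (u - z) < 3 / 2 * d"
        using v norm_triangle_ineq[of "u - v" "v - z"] by (simp add: norm_minus_commute)
      then have "4 * cmod (u - z) < 6 * d" by simp
      also have "6 * d \<le> 12 * d * cmod z" using d False by simp
      finally obtain t where t: "sgn u = cis t" "\<bar>t - s\<bar> < 12 * d"
        by (rule sgn_near_cis[OF u(1) z0 sz])
      have "1 - cmod u \<le> 1 - cmod v + cmod (u - v)"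
        using norm_triangle_ineq2[of v u] by (simp add: norm_minus_commute)
      also have "\<dots> < 24 * d" using v d \<open>cmod (u - v) < d / 2\<close> by simp
      moreover have "t \<in> J" using t(2) by (auto simp: J_def)
      ultimately show ?thesis using ball[OF u(2) v(1)] t(1) u(1) by (auto simp: Q)
    qed
    \<comment> \<open>Height below \<open>24 * d\<close> plus angular distance at most
      \<open>12 * d\<close> gives the radius \<open>36 * d\<close>, and
      \<open>1296 = 36\<^sup>2\<close>.\<close>
    have "Carleson_square (cis ` J) \<subseteq> ball (cis s) (36 * d) \<inter> unit_disc"
    proof
      fix u assume "u \<in> Carleson_square (cis ` J)"
      then obtain t where u: "u \<in> unit_disc" "u \<noteq> 0" "sgn u = cis t" "t \<in> J" "1 - cmod u < 24 * d"
        unfolding Q by auto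
      have "\<bar>t - s\<bar> \<le> 12 * d" using u by (auto simp: J_def)
      then have "cmod (u - cis s) < 36 * d" using norm_diff_cis_le[OF u(1-3), of s] u by linarith
      then show "u \<in> ball (cis s) (36 * d) \<inter> unit_disc" using u by (simp add: dist_norm norm_minus_commute)
    qed
    then have "emeasure disc_area (Carleson_square (cis ` J)) \<le> emeasure disc_area (ball (cis s) (36 * d) \<inter> unit_disc)"
      by (rule emeasure_mono) (auto simp: sets_disc_area)
    also have "\<dots> \<le> ennreal ((36 * d)\<^sup>2)" using d by (intro emeasure_disc_area_ball_le) simp
    finally have "emeasure disc_area (Carleson_square (cis ` J)) \<le> ennreal (1296 * d\<^sup>2)"
      by (simp add: power_mult_distrib)
    moreover note circle_arcsI[OF J]
    moreover have "ball z ((1 - cmod z) / 2) - {0} \<subseteq> Carleson_square (cis ` J)"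
      by (intro subsetI sub[of _ z]) (use z d in auto)
    moreover have "ball \<zeta> ((1 - cmod \<zeta>) / 2) - {0} \<subseteq> Carleson_square (cis ` J)"
      by (intro subsetI sub[of _ \<zeta>]) (use \<zeta> d in auto)
    ultimately show ?thesis using that by (simp add: d_def)
  qed
qed

section \<open>Bounds for averages from bounds for the integral and the area\<close>

lemma disc_average_ge:
  assumes "emeasure disc_area Q \<le> ennreal U" "emeasure disc_area Q \<noteq> 0" "0 \<le> x"
    and "ennreal x \<le> (\<integral>\<^sup>+z\<in>Q. ennreal (w z) \<partial>disc_area)"
  shows "ennreal (x / U) \<le> disc_average Q w"
proof -
  obtain q where q: "emeasure disc_area Q = ennreal q" "0 \<le> q"
    using assms(1) by (cases "emeasure disc_area Q") (auto simp: top_unique)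
  with assms have "0 < q" by (auto simp: less_le)
  moreover have "U \<ge> q"
    using assms q \<open>0 < q\<close> by (cases "U \<ge> 0") (auto simp: ennreal_le_iff ennreal_neg)
  ultimately have "ennreal (x / U) \<le> ennreal (x / q)"
    using assms by (intro ennreal_leI divide_left_mono) auto
  also have "\<dots> = ennreal x / ennreal q" using \<open>0 < q\<close> assms by (simp add: divide_ennreal)
  also have "\<dots> \<le> disc_average Q w"
    unfolding disc_average_def q by (rule divide_right_mono_ennreal[OF assms(4)])
  finally show ?thesis .
qed

lemma disc_average_le:
  assumes "ennreal U \<le> emeasure disc_area Q" "0 < U" "0 \<le> x"
    and "(\<integral>\<^sup>+z\<in>Q. ennreal (w z) \<partial>disc_area) \<le> ennreal x"
  shows "disc_average Q w \<le> ennreal (x / U)"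
proof -
  have "emeasure disc_area Q \<le> 1"
    using emeasure_space[of disc_area Q] by (simp add: emeasure_disc_area_space)
  then obtain q where q: "emeasure disc_area Q = ennreal q" "0 \<le> q"
    by (cases "emeasure disc_area Q") (auto simp: top_unique)
  with assms have "U \<le> q" by (simp add: ennreal_le_iff)
  have "disc_average Q w \<le> ennreal x / ennreal q"
    unfolding disc_average_def q by (rule divide_right_mono_ennreal[OF assms(4)])
  also have "\<dots> = ennreal (x / q)" using assms \<open>U \<le> q\<close> by (intro divide_ennreal) auto
  also have "\<dots> \<le> ennreal (x / U)"
    using assms \<open>U \<le> q\<close> by (intro ennreal_leI divide_left_mono) auto
  finally show ?thesis .
qed

section \<open>From slow growth to the weight condition\<close>

lemma emeasure_Carleson_square_layer_le:
  assumes ab: "a < b" "b \<le> a + 2 * pi" and J: "{a<..<b} \<subseteq> J" "J \<subseteq> {a..b}"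
    and \<tau>: "0 < \<tau>" "\<tau> \<le> 1"
  defines "h \<equiv> min (b - a) 1"
  \<comment> \<open>Arcs are up to \<open>2 * pi\<close> long, so the side of the square is the minimum of arc length and radius.\<close>
  shows "emeasure disc_area {u \<in> Carleson_square (cis ` J). 1 - cmod u \<le> \<tau> * h} \<le> ennreal (90 * \<tau> * h\<^sup>2)"
proof -
  \<comment> \<open>The layer is covered by discs around points of the circle at spacing \<open>\<delta>\<close>.\<close>
  define \<delta> where "\<delta> = \<tau> * h"
  define n where "n = nat \<lfloor>(b - a) / \<delta>\<rfloor>"
  have h: "0 < h" "h \<le> 1" "b - a \<le> 2 * pi * h"
    using ab pi_gt3 by (auto simp: h_def min_def)
  have \<delta>: "0 < \<delta>" using h \<tau> by (simp add: \<delta>_def)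
  define S where "S = (\<lambda>i. ball (cis (a + real i * \<delta>)) (3 * \<delta>) \<inter> unit_disc)"
  have S: "S i \<in> sets disc_area" for i by (auto simp: S_def sets_disc_area)
  have "{u \<in> Carleson_square (cis ` J). 1 - cmod u \<le> \<tau> * h} \<subseteq> (\<Union>i\<in>{..n}. S i)"
  proof
    fix u assume "u \<in> {u \<in> Carleson_square (cis ` J). 1 - cmod u \<le> \<tau> * h}"
    then obtain t where u: "u \<in> unit_disc" "u \<noteq> 0" "sgn u = cis t" "t \<in> J" "1 - cmod u \<le> \<delta>"
      by (auto simp: Carleson_square_arc[OF ab J] \<delta>_def)
    \<comment> \<open>This picks the last grid angle not beyond \<open>t\<close>. The radial and the
      angular distance are each at most \<open>\<delta>\<close>, so radius
      \<open>3 * \<delta>\<close> suffices with strict inequality.\<close>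
    define i where "i = nat \<lfloor>(t - a) / \<delta>\<rfloor>"
    have t: "a \<le> t" "t \<le> b" using u J by auto
    have "i \<le> n" unfolding i_def n_def
      using t \<delta> by (intro nat_mono floor_mono divide_right_mono) auto
    have "real i = of_int \<lfloor>(t - a) / \<delta>\<rfloor>" using t \<delta> by (simp add: i_def)
    then have "real i \<le> (t - a) / \<delta>" "(t - a) / \<delta> < real i + 1" by linarith+
    then have "\<bar>t - (a + real i * \<delta>)\<bar> \<le> \<delta>" using \<delta> by (simp add: field_simps abs_le_iff)
    then have "cmod (u - cis (a + real i * \<delta>)) < 3 * \<delta>"
      using norm_diff_cis_le[OF u(1-3), of "a + real i * \<delta>"] u \<delta> by linarith
    then show "u \<in> (\<Union>i\<in>{..n}. S i)"
      using u \<open>i \<le> n\<close> by (auto simp: S_def dist_norm norm_minus_commute)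
  qed
  then have "emeasure disc_area {u \<in> Carleson_square (cis ` J). 1 - cmod u \<le> \<tau> * h}
      \<le> emeasure disc_area (\<Union>i\<in>{..n}. S i)"
    using S by (intro emeasure_mono) auto
  also have "\<dots> \<le> (\<Sum>i\<le>n. emeasure disc_area (S i))"
    using S by (intro emeasure_subadditive_finite) auto
  also have "\<dots> \<le> (\<Sum>i\<le>n. ennreal ((3 * \<delta>)\<^sup>2))"
    unfolding S_def using \<delta> by (intro sum_mono emeasure_disc_area_ball_le) auto
  also have "\<dots> = ennreal ((real n + 1) * (9 * \<delta>\<^sup>2))"
    by (simp add: power_mult_distrib ennreal_of_nat_eq_real_of_nat ennreal_mult[symmetric] add.commute flip: ennreal_plus)
  also have "\<dots> \<le> ennreal (90 * \<tau> * h\<^sup>2)"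
  proof (rule ennreal_leI)
    \<comment> \<open>The number of discs is at most \<open>9 / \<tau>\<close>:
      \<open>2 * pi \<le> 8\<close> bounds the number of steps, and
      \<open>1 \<le> 1 / \<tau>\<close> absorbs the extra disc at the start.\<close>
    have "real n \<le> (b - a) / \<delta>" using ab \<delta> by (simp add: n_def)
    also have "\<dots> \<le> 2 * pi * h / \<delta>" using h \<delta> by (intro divide_right_mono) auto
    also have "\<dots> = 2 * pi / \<tau>" using h by (simp add: \<delta>_def)
    also have "\<dots> \<le> 8 / \<tau>" using pi_less_4 \<tau> by (intro divide_right_mono) auto
    finally have "real n + 1 \<le> 8 / \<tau> + 1 / \<tau>" using \<tau> by (intro add_mono) auto
    then have "(real n + 1) * (9 * \<delta>\<^sup>2) \<le> (9 / \<tau>) * (9 * \<delta>\<^sup>2)"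
      by (intro mult_right_mono) (auto simp: add_divide_distrib[symmetric])
    also have "\<dots> = 81 * \<tau> * h\<^sup>2" using \<tau> by (simp add: \<delta>_def power2_eq_square)
    also have "\<dots> \<le> 90 * \<tau> * h\<^sup>2" using \<tau> by (intro mult_right_mono) auto
    finally show "(real n + 1) * (9 * \<delta>\<^sup>2) \<le> 90 * \<tau> * h\<^sup>2" .
  qed
  finally show ?thesis .
qed

text \<open>The square contains the disc of radius \<open>h / 20\<close> about its centre
  \<open>z\<close>. Since \<open>cmod z \<ge> 1 / 2\<close>, this radius keeps the angle within
  \<open>h / 2\<close> of the midpoint, and the height stays below \<open>h\<close>.\<close>

lemma emeasure_Carleson_square_ge:
  assumes ab: "a < b" "b \<le> a + 2 * pi" and J: "{a<..<b} \<subseteq> J" "J \<subseteq> {a..b}"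
  defines "h \<equiv> min (b - a) 1"
  shows "ennreal (h\<^sup>2 / 400) \<le> emeasure disc_area (Carleson_square (cis ` J))"
proof -
  define s where "s = (a + b) / 2"
  define z where "z = of_real (1 - h / 2) * cis s"
  have h: "0 < h" "h \<le> 1" "h \<le> b - a" using ab by (auto simp: h_def)
  have nz: "cmod z = 1 - h / 2" using h by (simp add: z_def norm_mult del: of_real_diff)
  then have z0: "z \<noteq> 0" using h by auto
  have sz: "sgn z = cis s"
    using z0 h unfolding sgn_div_norm nz by (simp add: z_def scaleR_conv_of_real field_simps)
  have "ball z (h / 20) \<subseteq> Carleson_square (cis ` J)"
  proof
    fix u assume "u \<in> ball z (h / 20)"
    then have uz: "cmod (u - z) < h / 20" by (simp add: dist_norm norm_minus_commute)
    have u: "cmod z - h / 20 < cmod u" "cmod u < cmod z + h / 20"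
      using uz norm_triangle_ineq2[of u z] norm_triangle_ineq2[of z u] by (simp_all add: norm_minus_commute)
    then have "u \<noteq> 0" using nz h by auto
    have "h * (1 / 2) \<le> h * cmod z" using h nz by (intro mult_left_mono) auto
    then have "4 * cmod (u - z) < h / 2 * cmod z" using uz h by linarith
    then obtain t where t: "sgn u = cis t" "\<bar>t - s\<bar> < h / 2"
      by (rule sgn_near_cis[OF \<open>u \<noteq> 0\<close> z0 sz])
    then have "t \<in> {a<..<b}" using h by (auto simp: s_def abs_less_iff field_simps)
    then have "t \<in> J" using J by auto
    then show "u \<in> Carleson_square (cis ` J)"
      using t(1) u nz h \<open>u \<noteq> 0\<close> by (auto simp: Carleson_square_arc[OF ab J])
  qed
  moreover from this have "emeasure disc_area (ball z (h / 20)) = ennreal ((h / 20)\<^sup>2)"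
    using Carleson_square_subset h by (intro emeasure_disc_area_ball) (blast, simp)
  ultimately show ?thesis
    using emeasure_mono[OF _ Carleson_square_sets[OF circle_arcsI[OF ab J]], of "ball z (h / 20)"]
    by (simp add: power_divide)
qed

text \<open>The ratio \<open>1 / 4\<close> makes the bound on \<open>sqrt (1 / s)\<close> double
  from one layer to the next. The layer index is the predecessor of the least \<open>k\<close> with
  \<open>(1 / 4) ^ k < s\<close>; that \<open>k\<close> is positive because
  \<open>s \<le> 1\<close>.\<close>

lemma inverse_sqrt_le_dyadic:
  assumes "0 < s" "s \<le> 1"
  obtains k :: nat where "s \<le> (1 / 4) ^ k" "sqrt (1 / s) \<le> 2 * 2 ^ k"
proof -
  have "\<exists>k. (1 / 4) ^ k < s" using assms by (intro real_arch_pow_inv) auto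
  then obtain k where k: "(1 / 4) ^ k < s" "\<And>i. i < k \<Longrightarrow> \<not> (1 / 4) ^ i < s"
    using exists_least_iff[of "\<lambda>k. (1 / 4) ^ k < s"] by auto
  then obtain i where i: "k = Suc i" using assms by (cases k) auto
  have "1 / s \<le> (2 * 2 ^ i)\<^sup>2"
  proof -
    have "(1 / 4) ^ Suc i \<le> s" using k i by simp
    then have "1 / s \<le> 4 ^ Suc i" using assms by (simp add: power_one_over field_simps)
    also have "(4::real) ^ Suc i = (2 ^ Suc i)\<^sup>2"
      by (simp add: power2_eq_square flip: power_mult_distrib)
    finally show ?thesis by simp
  qed
  then have "sqrt (1 / s) \<le> 2 * 2 ^ i" by (intro real_le_lsqrt) auto
  moreover have "s \<le> (1 / 4) ^ i" using k(2)[of i] i by simp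
  ultimately show ?thesis using that by blast
qed

text \<open>From layer to layer the bound on \<open>f\<close> doubles while the bound on the area
  drops by a factor of 4. The contributions form a geometric series of ratio \<open>1 / 2\<close>,
  with sum \<open>2 * 90 * 2 = 360\<close> times \<open>K * h\<^sup>2\<close>.\<close>

lemma nn_integral_Carleson_square_le:
  assumes ab: "a < b" "b \<le> a + 2 * pi" and J: "{a<..<b} \<subseteq> J" "J \<subseteq> {a..b}"
  defines "h \<equiv> min (b - a) 1"
  assumes K: "0 \<le> K" and f: "\<And>u. u \<in> Carleson_square (cis ` J) \<Longrightarrow> f u \<le> K * sqrt (h / (1 - cmod u))"
  shows "(\<integral>\<^sup>+u\<in>Carleson_square (cis ` J). ennreal (f u) \<partial>disc_area) \<le> ennreal (360 * K * h\<^sup>2)"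
proof -
  define Q where "Q = Carleson_square (cis ` J)"
  \<comment> \<open>The layers are nested, not disjoint. For an upper bound one suitable layer
    through each point is enough, as the other summands are nonnegative.\<close>
  define L where "L = (\<lambda>k. {u \<in> Q. 1 - cmod u \<le> (1 / 4) ^ k * h})"
  have h: "0 < h" "h \<le> 1" using ab by (auto simp: h_def)
  have Q: "Q \<in> sets disc_area" unfolding Q_def by (rule Carleson_square_sets[OF circle_arcsI[OF ab J]])
  have L: "L k \<in> sets disc_area" for k
  proof -
    have "L k = Q \<inter> {u. 1 - cmod u \<le> (1 / 4) ^ k * h}" by (auto simp: L_def)
    moreover have "{u::complex. 1 - cmod u \<le> (1 / 4) ^ k * h} \<in> sets lebesgue" by simp
    ultimately show ?thesis using Q unfolding sets_disc_area by auto
  qed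
  have "ennreal (f u) * indicator Q u \<le> (\<Sum>k. ennreal (K * (2 * 2 ^ k)) * indicator (L k) u)" for u
  proof (cases "u \<in> Q")
    case True
    then have u: "cmod u < 1" "u \<noteq> 0" "1 - cmod u < b - a"
      by (auto simp: Q_def Carleson_square_arc[OF ab J])
    define s where "s = (1 - cmod u) / h"
    have "1 - cmod u < h" using u by (simp add: h_def)
    then have "0 < s" "s \<le> 1" using u h by (auto simp: s_def)
    then obtain k where k: "s \<le> (1 / 4) ^ k" "sqrt (1 / s) \<le> 2 * 2 ^ k"
      by (rule inverse_sqrt_le_dyadic)
    have "u \<in> L k" using k(1) h True by (simp add: L_def s_def field_simps)
    have "f u \<le> K * sqrt (1 / s)" using f True by (simp add: Q_def s_def)
    also have "\<dots> \<le> K * (2 * 2 ^ k)" using k(2) K by (rule mult_left_mono)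
    finally have "ennreal (f u) * indicator Q u \<le> ennreal (K * (2 * 2 ^ k)) * indicator (L k) u"
      using True \<open>u \<in> L k\<close> by (simp add: ennreal_leI)
    also have "\<dots> = (\<Sum>i\<in>{k}. ennreal (K * (2 * 2 ^ i)) * indicator (L i) u)"
      by (simp del: sum_mult_indicator)
    also have "\<dots> \<le> (\<Sum>k. ennreal (K * (2 * 2 ^ k)) * indicator (L k) u)"
      by (rule sum_le_suminf) auto
    finally show ?thesis .
  qed auto
  then have "(\<integral>\<^sup>+u\<in>Q. ennreal (f u) \<partial>disc_area)
      \<le> (\<integral>\<^sup>+u. (\<Sum>k. ennreal (K * (2 * 2 ^ k)) * indicator (L k) u) \<partial>disc_area)"
    by (intro nn_integral_mono)
  also have "\<dots> = (\<Sum>k. \<integral>\<^sup>+u. ennreal (K * (2 * 2 ^ k)) * indicator (L k) u \<partial>disc_area)"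
    using L by (intro nn_integral_suminf borel_measurable_times borel_measurable_indicator) auto
  also have "\<dots> = (\<Sum>k. ennreal (K * (2 * 2 ^ k)) * emeasure disc_area (L k))"
    using L by (simp add: nn_integral_cmult_indicator)
  also have "\<dots> \<le> (\<Sum>k. ennreal (180 * K * h\<^sup>2 * (1 / 2) ^ k))"
  proof (rule suminf_le)
    fix k
    have "ennreal (K * (2 * 2 ^ k)) * emeasure disc_area (L k)
        \<le> ennreal (K * (2 * 2 ^ k)) * ennreal (90 * (1 / 4) ^ k * h\<^sup>2)"
      unfolding L_def Q_def h_def
      by (intro mult_left_mono emeasure_Carleson_square_layer_le[OF ab J]) (auto simp: power_le_one)
    also have "\<dots> = ennreal (180 * K * h\<^sup>2 * (2 ^ k * (1 / 4) ^ k))"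
      using K by (simp add: mult_ac flip: ennreal_mult)
    also have "2 ^ k * (1 / 4) ^ k = (1 / 2 :: real) ^ k" by (simp flip: power_mult_distrib)
    finally show "ennreal (K * (2 * 2 ^ k)) * emeasure disc_area (L k) \<le> ennreal (180 * K * h\<^sup>2 * (1 / 2) ^ k)" .
  qed auto
  also have "\<dots> = ennreal (360 * K * h\<^sup>2)"
  proof (rule suminf_ennreal_eq)
    show "(\<lambda>k. 180 * K * h\<^sup>2 * (1 / 2) ^ k) sums (360 * K * h\<^sup>2)"
      using sums_mult[OF geometric_sums[of "1 / 2 :: real"], of "180 * K * h\<^sup>2"] by (simp add: mult.assoc)
  qed (use K in simp)
  finally show ?thesis unfolding Q_def .
qed

text \<open>All of the square lies within \<open>5 * h\<close> of the point \<open>cis s\<close>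
  below the centre, so \<open>cmod (1 - cnj z * u) \<le> 6 * h\<close>. With
  \<open>1 - (cmod z)\<^sup>2 \<ge> h / 2\<close>, \<open>exp_hyperbolic_dist_upper\<close> gives
  the constant \<open>288 = 4 * 36 * 2\<close>.\<close>

lemma exp_hyperbolic_dist_Carleson_square_le:
  assumes ab: "a < b" "b \<le> a + 2 * pi" and J: "{a<..<b} \<subseteq> J" "J \<subseteq> {a..b}"
    and u: "u \<in> Carleson_square (cis ` J)"
  defines "h \<equiv> min (b - a) 1"
  defines "z \<equiv> of_real (1 - h / 2) * cis ((a + b) / 2)"
  shows "exp (2 * hyperbolic_dist z u) \<le> 288 * (h / (1 - cmod u))"
proof -
  obtain t where t: "u \<in> unit_disc" "u \<noteq> 0" "sgn u = cis t" "t \<in> J" "1 - cmod u < b - a"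
    using u by (auto simp: Carleson_square_arc[OF ab J])
  define s where "s = (a + b) / 2"
  have h: "0 < h" "h \<le> 1" "b - a \<le> 2 * pi * h"
    using ab pi_gt3 by (auto simp: h_def min_def)
  have nz: "cmod z = 1 - h / 2" using h by (simp add: z_def norm_mult del: of_real_diff)
  then have z: "z \<in> unit_disc" using h by simp
  \<comment> \<open>For a long arc, where \<open>h = 1\<close>, this says
    \<open>u \<noteq> 0\<close>; otherwise it is the height condition.\<close>
  have uh: "1 - cmod u < h" using t by (simp add: h_def)
  have "a \<le> t" "t \<le> b" using t(4) J by auto
  then have "\<bar>t - s\<bar> \<le> (b - a) / 2" by (auto simp: s_def abs_le_iff field_simps)
  also have "\<dots> \<le> pi * h" using h by simp
  also have "\<dots> \<le> 4 * h" using h pi_less_4 by (intro mult_right_mono) auto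
  finally have ts: "cmod (u - cis s) < 5 * h" using norm_diff_cis_le[OF t(1-3), of s] uh by linarith
  \<comment> \<open>Expand \<open>u\<close> around \<open>cis s\<close>, using
    \<open>cnj z * cis s = 1 - h / 2\<close>.\<close>
  have "1 - cnj z * u = of_real (h / 2) - of_real (1 - h / 2) * (cnj (cis s) * (u - cis s))"
    by (simp add: z_def s_def algebra_simps cis_cnj cis_mult)
  then have "cmod (1 - cnj z * u) \<le> cmod (of_real (h / 2)) + cmod (of_real (1 - h / 2) * (cnj (cis s) * (u - cis s)))"
    by (metis norm_triangle_ineq4)
  also have "\<dots> = h / 2 + (1 - h / 2) * cmod (u - cis s)"
    using h by (simp add: norm_mult del: of_real_diff of_real_divide)
  also have "(1 - h / 2) * cmod (u - cis s) \<le> cmod (u - cis s)"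
    using h by (intro mult_left_le_one_le) auto
  finally have d: "cmod (1 - cnj z * u) \<le> 6 * h" using ts h by linarith
  have u2: "1 - cmod u \<le> 1 - (cmod u)\<^sup>2" "1 - cmod z \<le> 1 - (cmod z)\<^sup>2"
    using t z by (simp_all add: power2_eq_square mult_left_le)
  have "exp (2 * hyperbolic_dist z u) \<le> 4 * ((cmod (1 - cnj z * u))\<^sup>2 / ((1 - (cmod z)\<^sup>2) * (1 - (cmod u)\<^sup>2)))"
    by (rule exp_hyperbolic_dist_upper[OF z t(1)])
  also have "\<dots> \<le> 4 * ((6 * h)\<^sup>2 / ((h / 2) * (1 - cmod u)))"
    using d u2 h t nz by (intro mult_left_mono frac_le power_mono mult_mono mult_pos_pos) auto
  also have "\<dots> = 288 * (h / (1 - cmod u))"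
    using h t by (simp add: power2_eq_square)
  finally show ?thesis .
qed

text \<open>Slope 1 in the hypothesis is what turns \<open>exp (hyperbolic_dist z u)\<close> into
  the integrable \<open>sqrt (h / (1 - cmod u))\<close>. The powers of \<open>h\<close> in integral
  and area cancel, and \<open>144000 = 360 * 400\<close>.\<close>

lemma disc_average_exp_le:
  fixes g :: "complex \<Rightarrow> complex"
  assumes ab: "a < b" "b \<le> a + 2 * pi" and J: "{a<..<b} \<subseteq> J" "J \<subseteq> {a..b}"
    and C: "\<And>z \<zeta>. z \<in> unit_disc \<Longrightarrow> \<zeta> \<in> unit_disc \<Longrightarrow> cmod (c * (g z - g \<zeta>)) \<le> C + hyperbolic_dist z \<zeta>"
  defines "z \<equiv> of_real (1 - min (b - a) 1 / 2) * cis ((a + b) / 2)"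
  shows "disc_average (Carleson_square (cis ` J)) (\<lambda>u. exp (Re (c * g u)))
    \<le> ennreal (144000 * (exp C * sqrt 288) * exp (Re (c * g z)))"
proof -
  define h where "h = min (b - a) 1"
  define K where "K = exp C * sqrt 288 * exp (Re (c * g z))"
  have h: "0 < h" "h \<le> 1" using ab by (auto simp: h_def)
  have z: "z \<in> unit_disc" using h by (simp add: z_def norm_mult flip: h_def del: of_real_diff)
  have bound: "exp (Re (c * g u)) \<le> K * sqrt (h / (1 - cmod u))" if u: "u \<in> Carleson_square (cis ` J)" for u
  proof -
    have ud: "u \<in> unit_disc" using u Carleson_square_subset by blast
    have "Re (c * g u) - Re (c * g z) \<le> cmod (c * (g z - g u))"
      using abs_Re_le_cmod[of "c * (g z - g u)"] by (simp add: algebra_simps)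
    also have "\<dots> \<le> C + hyperbolic_dist z u" by (rule C[OF z ud])
    finally have "exp (Re (c * g u)) \<le> exp (Re (c * g z) + C + hyperbolic_dist z u)" by simp
    also have "\<dots> = exp (Re (c * g z)) * exp C * exp (hyperbolic_dist z u)" by (simp add: exp_add)
    also have "exp (hyperbolic_dist z u) \<le> sqrt (288 * (h / (1 - cmod u)))"
      using exp_hyperbolic_dist_Carleson_square_le[OF ab J u, folded h_def z_def]
      by (intro real_le_rsqrt) (simp add: z_def h_def exp_double[symmetric])
    finally show ?thesis by (simp add: K_def real_sqrt_mult real_sqrt_divide mult_ac)
  qed
  have "disc_average (Carleson_square (cis ` J)) (\<lambda>u. exp (Re (c * g u)))
    \<le> ennreal (360 * K * h\<^sup>2 / (h\<^sup>2 / 400))"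
  proof (rule disc_average_le)
    show "(\<integral>\<^sup>+u\<in>Carleson_square (cis ` J). ennreal (exp (Re (c * g u))) \<partial>disc_area) \<le> ennreal (360 * K * h\<^sup>2)"
      unfolding h_def
      by (rule nn_integral_Carleson_square_le[OF ab J]) (use bound in \<open>auto simp: K_def h_def\<close>)
    show "ennreal (h\<^sup>2 / 400) \<le> emeasure disc_area (Carleson_square (cis ` J))"
      unfolding h_def by (rule emeasure_Carleson_square_ge[OF ab J])
  qed (use h in \<open>auto simp: K_def\<close>)
  also have "360 * K * h\<^sup>2 / (h\<^sup>2 / 400) = 144000 * (exp C * sqrt 288) * exp (Re (c * g z))"
    using h by (simp add: K_def)
  finally show ?thesis .
qed

lemma B2_weight_if_slow_growth:
  fixes g :: "complex \<Rightarrow> complex"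
  assumes g: "continuous_on unit_disc g"
    and slow: "\<And>\<epsilon>. \<epsilon> > 0 \<Longrightarrow> \<exists>C>0. \<forall>z\<in>unit_disc. \<forall>\<zeta>\<in>unit_disc.
      cmod (g z - g \<zeta>) \<le> C + \<epsilon> * hyperbolic_dist z \<zeta>"
  shows "B2_weight (\<lambda>z. exp (Re (c * g z)))"
proof -
  \<comment> \<open>This gives \<open>cmod c * \<epsilon> \<le> 1\<close>, also for
    \<open>c = 0\<close>, so \<open>c * g\<close> grows with slope at most 1.\<close>
  define \<epsilon> where "\<epsilon> = 1 / (cmod c + 1)"
  have \<epsilon>: "\<epsilon> > 0" by (simp add: \<epsilon>_def add_nonneg_pos)
  obtain C where C: "\<And>z \<zeta>. z \<in> unit_disc \<Longrightarrow> \<zeta> \<in> unit_disc \<Longrightarrow> cmod (g z - g \<zeta>) \<le> C + \<epsilon> * hyperbolic_dist z \<zeta>"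
    using slow[OF \<epsilon>] by blast
  define D where "D = cmod c * C"
  have D: "cmod (c * (g z - g \<zeta>)) \<le> D + hyperbolic_dist z \<zeta>" if "z \<in> unit_disc" "\<zeta> \<in> unit_disc" for z \<zeta>
  proof -
    have "cmod c * cmod (g z - g \<zeta>) \<le> cmod c * (C + \<epsilon> * hyperbolic_dist z \<zeta>)"
      using C[OF that] by (intro mult_left_mono) auto
    also have "\<dots> = D + (cmod c * \<epsilon>) * hyperbolic_dist z \<zeta>" by (simp add: D_def algebra_simps)
    also have "(cmod c * \<epsilon>) * hyperbolic_dist z \<zeta> \<le> hyperbolic_dist z \<zeta>"
      using hyperbolic_dist_nonneg[OF that]
      by (intro mult_left_le_one_le) (auto simp: \<epsilon>_def divide_le_eq add_nonneg_pos)
    finally show ?thesis by (simp add: norm_mult)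
  qed
  then have D': "cmod (- c * (g z - g \<zeta>)) \<le> D + hyperbolic_dist z \<zeta>" if "z \<in> unit_disc" "\<zeta> \<in> unit_disc" for z \<zeta>
    using that by (simp add: norm_mult)
  define w where "w = (\<lambda>z. exp (Re (c * g z)))"
  define M where "M = 144000 * (exp D * sqrt 288)"
  have M: "M > 0" by (simp add: M_def)
  have "B2_const_sq w \<le> ennreal (M * M)"
    unfolding B2_const_sq_def
  proof (rule SUP_least)
    fix I assume "I \<in> circle_arcs"
    then obtain J a b where I: "I = cis ` J" and ab: "a < b" "b \<le> a + 2 * pi"
      and J: "{a<..<b} \<subseteq> J" "J \<subseteq> {a..b}" by (auto simp: circle_arcs_def)
    define z where "z = of_real (1 - min (b - a) 1 / 2) * cis ((a + b) / 2)"
    define e where "e = exp (Re (c * g z))"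
    have "disc_average (Carleson_square I) w \<le> ennreal (M * e)"
      using disc_average_exp_le[OF ab J D] unfolding I w_def M_def e_def z_def .
    moreover have "disc_average (Carleson_square I) (\<lambda>z. inverse (w z)) \<le> ennreal (M * inverse e)"
      using disc_average_exp_le[OF ab J D'] unfolding I w_def M_def e_def z_def
      by (simp only: mult_minus_left uminus_complex.sel exp_minus)
    ultimately have "disc_average (Carleson_square I) w * disc_average (Carleson_square I) (\<lambda>z. inverse (w z))
        \<le> ennreal (M * e) * ennreal (M * inverse e)" by (rule mult_mono) auto
    also have "\<dots> = ennreal (M * M)" using M by (simp add: e_def flip: ennreal_mult)
    finally show "disc_average (Carleson_square I) w * disc_average (Carleson_square I) (\<lambda>z. inverse (w z))
        \<le> ennreal (M * M)" .
  qed
  then have fin: "B2_const_sq w < \<infinity>" by (simp add: le_less_trans)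
  have "integrable disc_area w"
  proof (rule integrableI_nonneg)
    show "w \<in> borel_measurable disc_area"
      unfolding w_def by (intro borel_measurable_disc_area continuous_intros g)
    show "AE x in disc_area. 0 \<le> w x" by (simp add: w_def)
    \<comment> \<open>The square over the full circle misses only a null set of the disc. Its
      average is finite, and an infinite integral over a set of finite area would make it
      infinite.\<close>
    let ?Q = "unit_disc - {0} :: complex set"
    have "disc_average ?Q w < \<infinity>"
      using le_less_trans[OF disc_average_exp_le[OF full_circle_interval D] ennreal_less_top]
      by (simp add: Carleson_square_circle w_def)
    moreover have "emeasure disc_area ?Q \<noteq> \<infinity>"
      using emeasure_space[of disc_area ?Q] by (auto simp: emeasure_disc_area_space top_unique)
    ultimately have "(\<integral>\<^sup>+z\<in>?Q. ennreal (w z) \<partial>disc_area) < \<infinity>"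
      by (cases "(\<integral>\<^sup>+z\<in>?Q. ennreal (w z) \<partial>disc_area) = \<infinity>")
        (auto simp: disc_average_def ennreal_top_divide less_top split: if_splits)
    moreover have "{0} \<in> null_sets disc_area"
      by (simp add: null_sets_def sets_disc_area emeasure_disc_area_singleton)
    then have "AE z in disc_area. z \<noteq> 0" by (rule AE_I') auto
    then have "AE z in disc_area. ennreal (w z) = ennreal (w z) * indicator ?Q z"
      using AE_space[of disc_area] by eventually_elim simp
    then have "(\<integral>\<^sup>+z. ennreal (w z) \<partial>disc_area) = (\<integral>\<^sup>+z\<in>?Q. ennreal (w z) \<partial>disc_area)"
      by (rule nn_integral_cong_AE)
    ultimately show "(\<integral>\<^sup>+z. ennreal (w z) \<partial>disc_area) < \<infinity>" by simp
  qed
  then show ?thesis using fin by (simp add: B2_weight_def w_def)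
qed

section \<open>From the weight condition to slow growth\<close>

text \<open>Every \<open>v\<close> in the disc of radius \<open>r = (1 - cmod z) / 2\<close> has
  \<open>1 - (cmod v)\<^sup>2 \<ge> r\<close>, so the derivative is at most \<open>B / r\<close>
  there. The mean value inequality on this convex disc gives \<open>B\<close>.\<close>

lemma Bloch_oscillation:
  assumes g: "g holomorphic_on unit_disc"
    and B: "\<And>z. z \<in> unit_disc \<Longrightarrow> (1 - (cmod z)\<^sup>2) * cmod (deriv g z) \<le> B"
    and z: "z \<in> unit_disc" and u: "u \<in> ball z ((1 - cmod z) / 2)"
  shows "cmod (g u - g z) \<le> B"
proof -
  define r where "r = (1 - cmod z) / 2"
  have r: "r > 0" using z by (simp add: r_def)
  have v: "v \<in> unit_disc" "r \<le> 1 - cmod v" if "v \<in> ball z r" for v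
  proof -
    have "cmod v \<le> cmod z + cmod (z - v)" using norm_triangle_ineq2[of v z] by (simp add: norm_minus_commute)
    also have "cmod (z - v) < r" using that by (simp add: dist_norm)
    finally have "cmod v < cmod z + r" by simp
    also have "\<dots> = 1 - r" by (simp add: r_def field_simps)
    finally show "v \<in> unit_disc" "r \<le> 1 - cmod v" using r by auto
  qed
  have "B \<ge> 0" using order_trans[OF norm_ge_zero, of "deriv g 0" B] B[of 0] by simp
  have "cmod (g u - g z) \<le> (B / r) * cmod (u - z)"
  proof (rule field_differentiable_bound[OF convex_ball])
    show "u \<in> ball z r" "z \<in> ball z r" using u r by (auto simp: r_def)
    fix v assume v': "v \<in> ball z r"
    have "g field_differentiable at v"
      using v[OF v'] g by (simp add: holomorphic_on_imp_differentiable_at)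
    then show "(g has_field_derivative deriv g v) (at v within ball z r)"
      by (simp add: field_differentiable_derivI has_field_derivative_at_within)
    have "(cmod v)\<^sup>2 \<le> cmod v"
      using v[OF v'] by (simp add: power2_eq_square mult_left_le)
    then have "r \<le> 1 - (cmod v)\<^sup>2" using v[OF v'] by linarith
    then have "r * cmod (deriv g v) \<le> (1 - (cmod v)\<^sup>2) * cmod (deriv g v)"
      by (rule mult_right_mono) simp
    also have "\<dots> \<le> B" by (rule B) (rule v[OF v'])
    finally show "cmod (deriv g v) \<le> B / r" using r by (simp add: field_simps)
  qed
  also have "\<dots> \<le> (B / r) * r"
    using u r \<open>B \<ge> 0\<close> by (intro mult_left_mono) (auto simp: r_def dist_norm norm_minus_commute)
  finally show ?thesis using r by simp
qed

lemma emeasure_punctured_ball: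
  assumes "ball z r \<subseteq> unit_disc" "r \<ge> 0"
  shows "emeasure disc_area (ball z r - {0}) = ennreal (r\<^sup>2)"
proof -
  have "{0} \<in> null_sets disc_area"
    by (simp add: null_sets_def sets_disc_area emeasure_disc_area_singleton)
  then show ?thesis
    using assms emeasure_disc_area_ball[OF assms]
    by (subst emeasure_Diff_null_set) (auto simp: sets_disc_area)
qed

text \<open>Only the part of the integral over the punctured disc is kept. Carleson squares omit the
  origin, and puncturing leaves the area \<open>r\<^sup>2\<close> unchanged.\<close>

lemma disc_average_ge_ball:
  assumes "ball z r \<subseteq> unit_disc" "0 < r" "ball z r - {0} \<subseteq> Q" "Q \<in> sets disc_area"
    and Q: "emeasure disc_area Q \<le> ennreal U"
    and w: "\<And>u. u \<in> ball z r \<Longrightarrow> m \<le> w u" and m: "0 \<le> m"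
  shows "ennreal (m * r\<^sup>2 / U) \<le> disc_average Q w"
proof (rule disc_average_ge[OF Q])
  have S: "ball z r - {0} \<in> sets disc_area" using assms by (auto simp: sets_disc_area)
  have e: "emeasure disc_area (ball z r - {0}) = ennreal (r\<^sup>2)"
    using assms by (intro emeasure_punctured_ball) auto
  have "ennreal (r\<^sup>2) \<le> emeasure disc_area Q"
    using emeasure_mono[OF assms(3,4)] e by simp
  then show "emeasure disc_area Q \<noteq> 0" using \<open>0 < r\<close> by (auto simp: ennreal_eq_0_iff)
  show "0 \<le> m * r\<^sup>2" using m by simp
  have "ennreal (m * r\<^sup>2) = (\<integral>\<^sup>+u. ennreal m * indicator (ball z r - {0}) u \<partial>disc_area)"
    using S e m by (simp add: nn_integral_cmult_indicator ennreal_mult)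
  also have "\<dots> \<le> (\<integral>\<^sup>+u\<in>Q. ennreal (w u) \<partial>disc_area)"
    using w assms(3) by (intro nn_integral_mono) (auto split: split_indicator intro!: ennreal_leI)
  finally show "ennreal (m * r\<^sup>2) \<le> \<dots>" .
qed

text \<open>The product of the two averages is quadratic in \<open>r * s / d\<^sup>2\<close>, up to
  constants. The reciprocal \<open>d\<^sup>2 / (r * s)\<close> is at most a constant times
  \<open>exp (2 * hyperbolic_dist z \<zeta>)\<close>, and squaring it produces the factor 4.\<close>

lemma B2_weight_exp_imp:
  assumes g: "g holomorphic_on unit_disc"
    and B: "\<And>z. z \<in> unit_disc \<Longrightarrow> (1 - (cmod z)\<^sup>2) * cmod (deriv g z) \<le> B"
    and b2: "B2_weight (\<lambda>z. exp (Re (c * g z)))"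
  obtains K where "\<And>z \<zeta>. z \<in> unit_disc \<Longrightarrow> \<zeta> \<in> unit_disc \<Longrightarrow>
    Re (c * (g z - g \<zeta>)) \<le> K + 4 * hyperbolic_dist z \<zeta>"
proof -
  define w where "w = (\<lambda>z. exp (Re (c * g z)))"
  obtain M where M: "B2_const_sq w = ennreal M" "0 \<le> M"
    using b2 by (cases "B2_const_sq w") (auto simp: B2_weight_def w_def)
  define A where "A = cmod c * B"
  \<comment> \<open>\<open>1296\<^sup>2\<close> comes from \<open>U\<^sup>2\<close>, one 16 from
    rewriting \<open>r * s\<close> as \<open>(2 * r) * (2 * s) / 4\<close>, the other from squaring
    the factor 4 in the bound below. \<open>M + 1\<close> keeps \<open>M'\<close> positive for
    \<open>ln\<close>.\<close>
  define M' where "M' = (M + 1) * exp (2 * A) * 1296\<^sup>2 * 16 * 16"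
  have M': "M' > 0" using M by (simp add: M'_def)
  have osc: "\<bar>Re (c * g u) - Re (c * g z)\<bar> \<le> A"
    if "z \<in> unit_disc" "u \<in> ball z ((1 - cmod z) / 2)" for u z
  proof -
    have "\<bar>Re (c * g u) - Re (c * g z)\<bar> \<le> cmod (c * (g u - g z))"
      using abs_Re_le_cmod[of "c * (g u - g z)"] by (simp add: algebra_simps)
    also have "\<dots> \<le> A" unfolding norm_mult A_def
      by (intro mult_left_mono Bloch_oscillation[OF g B that]) auto
    finally show ?thesis .
  qed
  have sub: "ball z ((1 - cmod z) / 2) \<subseteq> unit_disc" if "z \<in> unit_disc" for z
  proof
    fix v assume "v \<in> ball z ((1 - cmod z) / 2)"
    then have "cmod (v - z) * 2 < 1 - cmod z" by (simp add: dist_norm norm_minus_commute)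
    then have "cmod v < 1" using norm_triangle_ineq2[of v z] that by simp
    then show "v \<in> unit_disc" by simp
  qed
  show ?thesis
  proof (rule that[of "ln M'"])
    fix z \<zeta> :: complex assume z: "z \<in> unit_disc" and \<zeta>: "\<zeta> \<in> unit_disc"
    define d where "d = cmod (1 - cnj z * \<zeta>)"
    define r where "r = (1 - cmod z) / 2"
    define s where "s = (1 - cmod \<zeta>) / 2"
    define X where "X = Re (c * g z)"
    define Y where "Y = Re (c * g \<zeta>)"
    define U where "U = 1296 * d\<^sup>2"
    have pos: "r > 0" "s > 0" "d > 0" "U > 0"
      using z \<zeta> norm_one_minus_cnj_mult_pos[OF z \<zeta>] by (auto simp: r_def s_def d_def U_def)
    obtain I where I: "I \<in> circle_arcs" "ball z r - {0} \<subseteq> Carleson_square I"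
      "ball \<zeta> s - {0} \<subseteq> Carleson_square I"
      "emeasure disc_area (Carleson_square I) \<le> ennreal U"
      using exists_Carleson_square[OF z \<zeta>] unfolding r_def s_def d_def U_def by metis
    note Q = Carleson_square_sets[OF I(1)]
    have "ennreal (exp (X - A) * r\<^sup>2 / U) \<le> disc_average (Carleson_square I) w"
    proof (rule disc_average_ge_ball[OF _ _ I(2) Q I(4)])
      fix u assume "u \<in> ball z r"
      then have "\<bar>Re (c * g u) - X\<bar> \<le> A" unfolding X_def r_def by (rule osc[OF z])
      then show "exp (X - A) \<le> w u" unfolding w_def by simp
    qed (use sub[OF z] pos in \<open>auto simp: r_def simp del: mem_ball\<close>)
    moreover have "ennreal (exp (- Y - A) * s\<^sup>2 / U) \<le> disc_average (Carleson_square I) (\<lambda>z. inverse (w z))"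
    proof (rule disc_average_ge_ball[OF _ _ I(3) Q I(4)])
      fix u assume "u \<in> ball \<zeta> s"
      then have "\<bar>Re (c * g u) - Y\<bar> \<le> A" unfolding Y_def s_def by (rule osc[OF \<zeta>])
      then show "exp (- Y - A) \<le> inverse (w u)" unfolding w_def exp_minus[symmetric] by simp
    qed (use sub[OF \<zeta>] pos in \<open>auto simp: s_def simp del: mem_ball\<close>)
    ultimately have "ennreal (exp (X - A) * r\<^sup>2 / U) * ennreal (exp (- Y - A) * s\<^sup>2 / U)
        \<le> disc_average (Carleson_square I) w * disc_average (Carleson_square I) (\<lambda>z. inverse (w z))"
      by (rule mult_mono) auto
    also have "\<dots> \<le> ennreal M"
      unfolding M(1)[symmetric] B2_const_sq_def by (rule SUP_upper[OF I(1)])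
    finally have "(exp (X - A) * r\<^sup>2 / U) * (exp (- Y - A) * s\<^sup>2 / U) \<le> M"
      using M pos by (simp add: ennreal_mult[symmetric] ennreal_le_iff del: ennreal_mult)
    moreover have "exp (X - A) * exp (- Y - A) = exp (X - Y) / exp (2 * A)"
      by (simp add: exp_add[symmetric] exp_diff[symmetric])
    ultimately have "exp (X - Y) * (r * s)\<^sup>2 \<le> M * exp (2 * A) * U\<^sup>2"
      using pos by (simp add: field_simps power2_eq_square)
    then have "exp (X - Y) \<le> M * exp (2 * A) * U\<^sup>2 / (r * s)\<^sup>2"
      using pos by (simp add: field_simps)
    also have "\<dots> = M * exp (2 * A) * 1296\<^sup>2 * 16 * (d\<^sup>2 / (2 * r * (2 * s)))\<^sup>2"
      using pos by (simp add: U_def power2_eq_square field_simps)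
    also have "\<dots> \<le> M * exp (2 * A) * 1296\<^sup>2 * 16 * (4 * exp (2 * hyperbolic_dist z \<zeta>))\<^sup>2"
    proof -
      have bound: "1 - x\<^sup>2 \<le> 2 * (1 - x)" "0 < 1 - x\<^sup>2" if "0 \<le> x" "x < 1" for x :: real
      proof -
        have *: "1 - x\<^sup>2 = (1 + x) * (1 - x)" by (simp add: power2_eq_square algebra_simps)
        show "1 - x\<^sup>2 \<le> 2 * (1 - x)" unfolding * using that by (intro mult_right_mono) auto
        show "0 < 1 - x\<^sup>2" unfolding * using that by simp
      qed
      \<comment> \<open>Here \<open>2 * r = 1 - cmod z\<close> and
        \<open>2 * s = 1 - cmod \<zeta>\<close>, so each factor loses at most 2.\<close>
      have "(1 - (cmod z)\<^sup>2) * (1 - (cmod \<zeta>)\<^sup>2) \<le> (2 * (2 * r)) * (2 * (2 * s))"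
        using bound[of "cmod z"] bound[of "cmod \<zeta>"] z \<zeta> pos
        by (intro mult_mono) (auto simp: r_def s_def)
      then have "d\<^sup>2 / ((2 * (2 * r)) * (2 * (2 * s))) \<le> d\<^sup>2 / ((1 - (cmod z)\<^sup>2) * (1 - (cmod \<zeta>)\<^sup>2))"
        using bound[of "cmod z"] bound[of "cmod \<zeta>"] z \<zeta> pos
        by (intro divide_left_mono mult_pos_pos) auto
      also have "\<dots> \<le> exp (2 * hyperbolic_dist z \<zeta>)"
        unfolding d_def by (rule exp_hyperbolic_dist_lower[OF z \<zeta>])
      finally have "d\<^sup>2 / (2 * r * (2 * s)) \<le> 4 * exp (2 * hyperbolic_dist z \<zeta>)"
        using pos by (simp add: field_simps)
      then show ?thesis using M pos by (intro mult_left_mono power_mono) auto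
    qed
    also have "\<dots> \<le> M' * (exp (2 * hyperbolic_dist z \<zeta>))\<^sup>2"
      using M by (simp add: M'_def power_mult_distrib mult_right_mono)
    also have "\<dots> = exp (ln M' + 4 * hyperbolic_dist z \<zeta>)"
      using M' by (simp add: exp_add exp_double[symmetric] mult.commute)
    finally show "Re (c * (g z - g \<zeta>)) \<le> ln M' + 4 * hyperbolic_dist z \<zeta>"
      by (simp add: X_def Y_def algebra_simps)
  qed
qed

lemma slow_growth_if_B2:
  assumes "g \<in> Bloch" and b2: "\<And>c. B2_weight (\<lambda>z. exp (Re (c * g z)))" and "\<epsilon> > 0"
  shows "\<exists>C>0. \<forall>z\<in>unit_disc. \<forall>\<zeta>\<in>unit_disc. cmod (g z - g \<zeta>) \<le> C + \<epsilon> * hyperbolic_dist z \<zeta>"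
proof -
  obtain B where g: "g holomorphic_on unit_disc"
    and B: "\<And>z. z \<in> unit_disc \<Longrightarrow> (1 - (cmod z)\<^sup>2) * cmod (deriv g z) \<le> B"
    using assms(1) unfolding Bloch_def bdd_above_def by blast
  \<comment> \<open>The real and the imaginary part each contribute slope 4; dividing the sum 8 by
    \<open>R\<close> leaves \<open>\<epsilon>\<close>.\<close>
  define R where "R = 8 / \<epsilon>"
  have R: "R > 0" using assms by (simp add: R_def)
  have "\<exists>K. \<forall>z\<in>unit_disc. \<forall>\<zeta>\<in>unit_disc. Re (c * (g z - g \<zeta>)) \<le> K + 4 * hyperbolic_dist z \<zeta>" for c
    using B2_weight_exp_imp[OF g B b2] by metis
  then obtain K where K: "\<And>c z \<zeta>. z \<in> unit_disc \<Longrightarrow> \<zeta> \<in> unit_disc \<Longrightarrow>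
      Re (c * (g z - g \<zeta>)) \<le> K c + 4 * hyperbolic_dist z \<zeta>"
    by metis
  \<comment> \<open>One constant for all four directions; the summand 1 makes the final constant
    strictly positive.\<close>
  define L where "L = \<bar>K (of_real R)\<bar> + \<bar>K (- of_real R)\<bar> + \<bar>K (\<i> * of_real R)\<bar> + \<bar>K (- \<i> * of_real R)\<bar> + 1"
  show ?thesis
  proof (intro exI conjI ballI)
    show "2 * L / R > 0" using R by (simp add: L_def)
    fix z \<zeta> assume z: "z \<in> unit_disc" "\<zeta> \<in> unit_disc"
    define v where "v = g z - g \<zeta>"
    define H where "H = hyperbolic_dist z \<zeta>"
    have "R * \<bar>Re v\<bar> \<le> L + 4 * H"
      using K[OF z, of "of_real R"] K[OF z, of "- of_real R"]
      by (simp add: L_def H_def abs_if flip: v_def)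
    moreover have "R * \<bar>Im v\<bar> \<le> L + 4 * H"
      using K[OF z, of "\<i> * of_real R"] K[OF z, of "- \<i> * of_real R"]
      by (simp add: L_def H_def abs_if flip: v_def)
    ultimately have "R * (\<bar>Re v\<bar> + \<bar>Im v\<bar>) \<le> 2 * L + 8 * H" by (simp add: algebra_simps)
    moreover have "R * cmod v \<le> R * (\<bar>Re v\<bar> + \<bar>Im v\<bar>)"
      using R by (intro mult_left_mono cmod_le) auto
    ultimately have "cmod v \<le> (2 * L + 8 * H) / R" using R by (simp add: field_simps)
    also have "\<dots> = 2 * L / R + \<epsilon> * H" using assms by (simp add: R_def field_simps)
    finally show "cmod (g z - g \<zeta>) \<le> 2 * L / R + \<epsilon> * hyperbolic_dist z \<zeta>"
      by (simp add: v_def H_def)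
  qed
qed

theorem corollary1p3:
  fixes g :: "complex \<Rightarrow> complex"
  assumes "g \<in> Bloch"
  shows "(\<forall>c::complex. B2_weight (\<lambda>z. exp (Re (c * g z)))) \<longleftrightarrow>
    (\<forall>\<epsilon>::real. \<epsilon> > 0 \<longrightarrow> (\<exists>C::real. C > 0 \<and>
      (\<forall>z\<in>unit_disc. \<forall>\<zeta>\<in>unit_disc.
        cmod (g z - g \<zeta>) \<le> C + \<epsilon> * hyperbolic_dist z \<zeta>)))"
proof
  assume "\<forall>c. B2_weight (\<lambda>z. exp (Re (c * g z)))"
  then show "\<forall>\<epsilon>::real. \<epsilon> > 0 \<longrightarrow> (\<exists>C::real. C > 0 \<and>
      (\<forall>z\<in>unit_disc. \<forall>\<zeta>\<in>unit_disc. cmod (g z - g \<zeta>) \<le> C + \<epsilon> * hyperbolic_dist z \<zeta>))"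
    using slow_growth_if_B2[OF assms] by blast
next
  assume slow: "\<forall>\<epsilon>::real. \<epsilon> > 0 \<longrightarrow> (\<exists>C::real. C > 0 \<and>
      (\<forall>z\<in>unit_disc. \<forall>\<zeta>\<in>unit_disc. cmod (g z - g \<zeta>) \<le> C + \<epsilon> * hyperbolic_dist z \<zeta>))"
  have "continuous_on unit_disc g"
    using assms by (simp add: Bloch_def holomorphic_on_imp_continuous_on)
  then show "\<forall>c. B2_weight (\<lambda>z. exp (Re (c * g z)))"
    using B2_weight_if_slow_growth slow by blast
qed

end
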